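(* Let $F=L^{d-j}M^j$ for $1\leq j\leq d/2$, with linearly independent linear forms $L=a_0x_0+a_1x_1$, $M=b_0x_0+b_1x_1$ in $\mathbb{C}[x_0,x_1]$. Denote $\widetilde{L}=-a_1x_0+a_0x_1$ and $\widetilde{M}=-b_1x_0+b_0x_1$. Let $Q_1,Q_2$ be the solutions (in $\mathbb{P}^1$) of the quadric $$D= \det \begin{bmatrix}(d-j)M & jL \\ -\widetilde{M} & \widetilde{L}\end{bmatrix}=0.$$ Then, if $j=1$, $\mathrm{Eig}(F)=\{[L^\perp], [Q_1],[Q_2]\}$; otherwise $\mathrm{Eig}(F)=\{[L^\perp],[M^\perp], [Q_1],[Q_2]\}$.
   Context: Work over $\mathbb{C}$. A linear form $a_0x_0+a_1x_1$ is identified with the vector $(a_0,a_1)$, so $\mathbb{P}(\mathrm{Sym}^1(\mathbb{C}^2))\cong\mathbb{P}^1$. For $F\in\mathbb{C}[x_0,x_1]_d$, the eigenscheme $\mathrm{Eig}(F)\subset\mathbb{P}(\mathrm{Sym}^1(\mathbb{C}^2))$ is the scheme defined by $\det\begin{bmatrix}\nabla F(x)\\ x\end{bmatrix}=0$; the equalities in the claim describe its points (its support). For a nonzero linear form $L$, $[L^\perp]$ is the class of the linear form, unique up to scalar, with $\langle L^\perp,L\rangle_{\mathbb{C}}=0$, where $\langle u,v\rangle_{\mathbb{C}}=u_0v_0+u_1v_1$.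
   Formalization: The case d=2, j=1 is excluded (d≥3 is assumed), because there Eig(F)={[Q1],[Q2]} and [L^⊥] need not belong to it, e.g. F=x_0x_1; the quadric D is also taken to be not identically zero, so that Q1, Q2 are defined. *)

theory Defs
  imports "HOL-Analysis.Analysis" "HOL-Computational_Algebra.Polynomial"
begin

text \<open>
  The ring of polynomials in \<open>x\<^sub>0, x\<^sub>1\<close> over the complex numbers is
  \<^typ>\<open>complex poly poly\<close>: the outer indeterminate is \<open>x\<^sub>1\<close>, the
  coefficients are polynomials in \<open>x\<^sub>0\<close>.  Coordinates \<open>0, 1\<close> of the mathematics
  are the components \<open>$ 1\<close>, \<open>$ 2\<close> of vectors in \<^typ>\<open>complex ^ 2\<close>.
\<close>

definition X0 :: "complex poly poly" where
  "X0 = [:[:0, 1:]:]"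

definition X1 :: "complex poly poly" where
  "X1 = [:0, 1:]"

definition eval2 :: "complex poly poly \<Rightarrow> complex ^ 2 \<Rightarrow> complex" where
  "eval2 F v = poly (poly F [:v $ 2:]) (v $ 1)"

definition linform :: "complex ^ 2 \<Rightarrow> complex poly poly" where
  "linform a = [:[:a $ 1:]:] * X0 + [:[:a $ 2:]:] * X1"

text \<open>The coefficient vector of the form written with a tilde, \<open>- a\<^sub>1 x\<^sub>0 + a\<^sub>0 x\<^sub>1\<close>.\<close>

definition rot :: "complex ^ 2 \<Rightarrow> complex ^ 2" where
  "rot a = vector [- (a $ 2), a $ 1]"

text \<open>\<open>map_poly pderiv\<close> differentiates the coefficients, i.e. with respect to \<open>x\<^sub>0\<close>.\<close>

definition gradient :: "complex poly poly \<Rightarrow> complex poly poly ^ 2" where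
  "gradient F = vector [map_poly pderiv F, pderiv F]"

definition proj_rel :: "((complex ^ 2) \<times> (complex ^ 2)) set" where
  "proj_rel = {(u, v). u \<noteq> 0 \<and> v \<noteq> 0 \<and> (\<exists>c. c \<noteq> 0 \<and> v = c *s u)}"

text \<open>
  The projective line, which is also the space of nonzero linear forms up to scalar:
  a form is identified with its coefficient vector.
\<close>

definition P1 :: "(complex ^ 2) set set" where
  "P1 = (UNIV - {0}) // proj_rel"

text \<open>Intended for homogeneous \<open>G\<close>, for which the condition does not depend on the representative.\<close>

definition proj_zeros :: "complex poly poly \<Rightarrow> (complex ^ 2) set set" where
  "proj_zeros G = {p \<in> P1. \<forall>v\<in>p. eval2 G v = 0}"

definition eig_poly :: "complex poly poly \<Rightarrow> complex poly poly" where
  "eig_poly F = det (vector [gradient F, vector [X0, X1]] :: complex poly poly ^ 2 ^ 2)"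

text \<open>The set of points (the support) of the eigenscheme of a binary form.\<close>

definition Eig :: "complex poly poly \<Rightarrow> (complex ^ 2) set set" where
  "Eig F = proj_zeros (eig_poly F)"

text \<open>
  For \<open>a \<noteq> 0\<close>: the class of the vectors orthogonal to \<open>a\<close>; \<^const>\<open>scalar_product\<close>
  is the bilinear (not the Hermitian) product.
\<close>

definition perp_class :: "complex ^ 2 \<Rightarrow> (complex ^ 2) set" where
  "perp_class a = (THE p. p \<in> P1 \<and> (\<forall>u\<in>p. scalar_product u a = 0))"

text \<open>The quadric \<open>D\<close> attached to \<open>F = L ^ (d - j) * M ^ j\<close>, where \<open>L, M\<close> have coefficients \<open>a, b\<close>.\<close>

definition D_quadric :: "nat \<Rightarrow> nat \<Rightarrow> complex ^ 2 \<Rightarrow> complex ^ 2 \<Rightarrow> complex poly poly" where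
  "D_quadric d j a b =
     det (vector [vector [of_nat (d - j) * linform b, of_nat j * linform a],
                  vector [- linform (rot b), linform (rot a)]] :: complex poly poly ^ 2 ^ 2)"

end

theory Submission
  imports Defs
begin

text \<open>
  The eigenscheme equation of \<open>F = L\<^sup>m M\<^sup>k\<close> factors.  The rows of its determinant are
  \<open>\<nabla>F\<close> and \<open>(x\<^sub>0, x\<^sub>1)\<close>, so it is the value at \<open>F\<close> of the derivation
  \<open>x\<^sub>1 \<partial>\<^sub>0 - x\<^sub>0 \<partial>\<^sub>1\<close>.  The Leibniz rule extracts \<open>L\<^sup>m\<^sup>-\<^sup>1 M\<^sup>k\<^sup>-\<^sup>1\<close> from \<open>F\<close>
  (lemma \<open>derivation_mult_powers\<close>), and since the derivation sends a linear form to its tilde,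
  the remaining factor \<open>m M \<delta>L + k L \<delta>M\<close> is exactly the quadric \<open>D\<close> (lemma \<open>eig_poly_factor\<close>).

  The support of the zero scheme of a product is the union of the supports
  (lemma \<open>proj_zeros_mult\<close>), and a nonzero linear form vanishes at a single point of the
  projective line, its orthogonal class (lemma \<open>proj_zeros_linform\<close>).  With \<open>m = d - j \<ge> 2\<close>
  and \<open>k = j\<close>, the point \<open>[L\<^sup>\<bottom>]\<close> always occurs, while \<open>[M\<^sup>\<bottom>]\<close> is contributed by
  \<open>M\<^sup>j\<^sup>-\<^sup>1\<close>, a factor that is constant when \<open>j = 1\<close>.
\<close>

lemma derivation_power:
  fixes \<delta> :: "'a::comm_ring_1 \<Rightarrow> 'a"
  assumes leibniz: "\<And>p q. \<delta> (p * q) = \<delta> p * q + p * \<delta> q"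
  shows "\<delta> (p ^ n) = of_nat n * p ^ (n - 1) * \<delta> p"
proof (induction n)
  case 0
  show ?case using leibniz[of 1 1] by simp
next
  case (Suc n)
  have "\<delta> (p ^ Suc n) = \<delta> p * p ^ n + p * (of_nat n * p ^ (n - 1) * \<delta> p)"
    using leibniz[of p "p ^ n"] Suc.IH by simp
  also have "\<dots> = of_nat (Suc n) * p ^ n * \<delta> p"
    by (cases n) (simp_all add: algebra_simps)
  finally show ?case by simp
qed

lemma derivation_mult_powers:
  fixes \<delta> :: "'a::comm_ring_1 \<Rightarrow> 'a"
  assumes leibniz: "\<And>p q. \<delta> (p * q) = \<delta> p * q + p * \<delta> q"
    and "1 \<le> m" "1 \<le> k"
  shows "\<delta> (p ^ m * q ^ k) =
           p ^ (m - 1) * q ^ (k - 1) * (of_nat m * q * \<delta> p + of_nat k * p * \<delta> q)"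
proof -
  obtain m' k' where "m = Suc m'" "k = Suc k'"
    using assms(2,3) by (metis Suc_pred' less_eq_Suc_le One_nat_def)
  moreover have "\<delta> (x ^ Suc n) = of_nat (Suc n) * x ^ n * \<delta> x" for x n
    using derivation_power[of \<delta>, OF leibniz, of x "Suc n"] by simp
  ultimately show ?thesis
    unfolding leibniz by (simp del: of_nat_Suc add: algebra_simps)
qed

text \<open>
  The derivative in the inner indeterminate acts coefficientwise, so the Leibniz rule follows
  from the one for each summand of the convolution formula for coefficients of a product.
\<close>

lemma map_poly_pderiv_mult:
  fixes p q :: "'a::idom poly poly"
  shows "map_poly pderiv (p * q) = map_poly pderiv p * q + p * map_poly pderiv q"
proof (rule poly_eqI)
  fix n
  have "coeff (map_poly pderiv (p * q)) n =
      (\<Sum>i\<le>n. pderiv (coeff p i) * coeff q (n - i) + coeff p i * pderiv (coeff q (n - i)))"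
    using higher_pderiv_sum[of 1 "\<lambda>i. coeff p i * coeff q (n - i)" "{..n}"]
    by (simp add: coeff_map_poly coeff_mult pderiv_mult add.commute mult.commute)
  then show "coeff (map_poly pderiv (p * q)) n =
      coeff (map_poly pderiv p * q + p * map_poly pderiv q) n"
    by (simp add: coeff_map_poly coeff_mult sum.distrib)
qed

lemma linform_pCons: "linform a = [:[:0, a $ 1:], [:a $ 2:]:]"
  by (simp add: linform_def X0_def X1_def)

lemma map_poly_pderiv_linform: "map_poly pderiv (linform a) = [:[:a $ 1:]:]"
  by (simp add: linform_pCons map_poly_pCons pderiv_pCons)

lemma pderiv_linform: "pderiv (linform a) = [:[:a $ 2:]:]"
  by (simp add: linform_pCons pderiv_pCons)

lemma eig_poly_eq: "eig_poly F = map_poly pderiv F * X1 - pderiv F * X0"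
  by (simp add: eig_poly_def gradient_def det_2)

lemma eig_poly_mult: "eig_poly (p * q) = eig_poly p * q + p * eig_poly q"
  by (simp add: eig_poly_eq map_poly_pderiv_mult pderiv_mult algebra_simps)

lemma eig_poly_linform: "eig_poly (linform a) = linform (rot a)"
  unfolding eig_poly_eq map_poly_pderiv_linform pderiv_linform
  by (simp add: linform_def rot_def X0_def X1_def)

lemma D_quadric_eq:
  "D_quadric d j a b = of_nat (d - j) * linform b * linform (rot a)
     + of_nat j * linform a * linform (rot b)"
  by (simp add: D_quadric_def det_2)

lemma eig_poly_factor:
  assumes "1 \<le> d - j" "1 \<le> j"
  shows "eig_poly (linform a ^ (d - j) * linform b ^ j) =
           linform a ^ (d - j - 1) * linform b ^ (j - 1) * D_quadric d j a b"
  using derivation_mult_powers[of eig_poly, OF eig_poly_mult assms, of "linform a" "linform b"]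
  by (simp add: eig_poly_linform D_quadric_eq)

lemma eval2_mult: "eval2 (F * G) v = eval2 F v * eval2 G v"
  by (simp add: eval2_def)

lemma eval2_power: "eval2 (F ^ n) v = eval2 F v ^ n"
  by (simp add: eval2_def)

lemma eval2_linform: "eval2 (linform a) v = scalar_product v a"
  by (simp add: eval2_def linform_pCons scalar_product_def sum_2 algebra_simps)

lemma P1_nonempty: "p \<in> P1 \<Longrightarrow> p \<noteq> {}"
  by (auto simp: P1_def quotient_def proj_rel_def intro!: exI[of _ 1])

lemma P1_proportional:
  assumes "p \<in> P1" "u \<in> p" "v \<in> p"
  obtains c where "v = c *s u"
proof -
  from assms obtain w c c' where "u = c *s w" "v = c' *s w" "c \<noteq> 0"
    by (auto simp: P1_def quotient_def proj_rel_def)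
  then have "v = (c' / c) *s u" by simp
  then show ?thesis by (rule that)
qed

text \<open>
  Scaling invariance is required of one factor only: if that factor is nonzero at one
  representative of a point, it is nonzero at all of them, and then the other factor must vanish
  at all of them.
\<close>

lemma proj_zeros_mult:
  assumes scale: "\<And>c v. eval2 G v = 0 \<Longrightarrow> eval2 G (c *s v) = 0"
  shows "proj_zeros (G * H) = proj_zeros G \<union> proj_zeros H"
proof
  show "proj_zeros (G * H) \<subseteq> proj_zeros G \<union> proj_zeros H"
  proof
    fix p assume p: "p \<in> proj_zeros (G * H)"
    then have P: "p \<in> P1" by (simp add: proj_zeros_def)
    show "p \<in> proj_zeros G \<union> proj_zeros H"
    proof (cases "\<exists>u\<in>p. eval2 G u = 0")
      case True
      then have "\<forall>v\<in>p. eval2 G v = 0"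
        using P1_proportional[OF P] scale by metis
      then show ?thesis using P by (simp add: proj_zeros_def)
    next
      case False
      then show ?thesis using p by (auto simp: proj_zeros_def eval2_mult)
    qed
  qed
qed (auto simp: proj_zeros_def eval2_mult)

lemma proj_zeros_power:
  "proj_zeros (G ^ n) = (if n = 0 then {} else proj_zeros G)"
proof (cases n)
  case 0
  then show ?thesis
    using P1_nonempty by (auto simp: proj_zeros_def eval2_def)
next
  case (Suc m)
  then show ?thesis by (simp add: proj_zeros_def eval2_power del: power_Suc)
qed

lemma scalar_product_eq_0_iff_rot:
  assumes "a \<noteq> 0"
  shows "scalar_product v a = 0 \<longleftrightarrow> (\<exists>c. v = c *s rot a)"
proof
  assume "scalar_product v a = 0"
  then have eq: "v $ 1 * a $ 1 + v $ 2 * a $ 2 = 0"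
    by (simp add: scalar_product_def sum_2)
  show "\<exists>c. v = c *s rot a"
  proof (cases "a $ 1 = 0")
    case True
    with assms have "a $ 2 \<noteq> 0" by (auto simp: vec_eq_iff forall_2)
    with True eq have "v = (- (v $ 1) / a $ 2) *s rot a"
      by (simp add: vec_eq_iff forall_2 rot_def)
    then show ?thesis ..
  next
    case False
    with eq have "v = (v $ 2 / a $ 1) *s rot a"
      by (simp add: vec_eq_iff forall_2 rot_def field_simps add_eq_0_iff2)
    then show ?thesis ..
  qed
qed (auto simp: scalar_product_def sum_2 rot_def algebra_simps)

text \<open>
  The equation \<open>\<langle>v, a\<rangle> = 0\<close> has a one-dimensional solution space, spanned by \<open>rot a\<close>.
  Hence exactly one point satisfies it, which also shows that the definite description in
  \<^const>\<open>perp_class\<close> is meaningful.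
\<close>

lemma proj_zeros_linform:
  assumes "a \<noteq> 0"
  shows "proj_zeros (linform a) = {perp_class a}"
proof -
  define r where "r = proj_rel `` {rot a}"
  have rot: "rot a \<noteq> 0"
    using assms by (auto simp: rot_def vec_eq_iff forall_2)
  have *: "p \<in> P1 \<and> (\<forall>u\<in>p. scalar_product u a = 0) \<longleftrightarrow> p = r" for p
  proof
    assume p: "p \<in> P1 \<and> (\<forall>u\<in>p. scalar_product u a = 0)"
    then obtain w where w: "w \<noteq> 0" "p = proj_rel `` {w}"
      by (auto simp: P1_def quotient_def)
    then have "w \<in> p" by (auto simp: proj_rel_def intro!: exI[of _ 1])
    then obtain c where c: "w = c *s rot a"
      using p scalar_product_eq_0_iff_rot[OF assms] by blast
    then have c0: "c \<noteq> 0" using w by auto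
    show "p = r"
    proof (intro set_eqI iffI)
      fix x assume "x \<in> p"
      then obtain k where k: "x \<noteq> 0" "k \<noteq> 0" "x = k *s w"
        using w by (auto simp: proj_rel_def)
      then have "x = (k * c) *s rot a" "k * c \<noteq> 0" using c c0 by auto
      then show "x \<in> r" using rot k by (auto simp: r_def proj_rel_def)
    next
      fix x assume "x \<in> r"
      then obtain k where k: "x \<noteq> 0" "k \<noteq> 0" "x = k *s rot a"
        by (auto simp: r_def proj_rel_def)
      then have "x = (k / c) *s w" "k / c \<noteq> 0" using c c0 by auto
      then show "x \<in> p" using w k by (auto simp: proj_rel_def)
    qed
  next
    assume "p = r"
    moreover have "r \<in> P1" using rot by (auto simp: r_def P1_def intro: quotientI)
    moreover have "\<forall>u\<in>r. scalar_product u a = 0"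
      using scalar_product_eq_0_iff_rot[OF assms] by (auto simp: r_def proj_rel_def)
    ultimately show "p \<in> P1 \<and> (\<forall>u\<in>p. scalar_product u a = 0)" by simp
  qed
  have "perp_class a = r" unfolding perp_class_def * by simp
  moreover have "proj_zeros (linform a) = {r}"
    unfolding proj_zeros_def eval2_linform * by simp
  ultimately show ?thesis by simp
qed

lemma proj_zeros_linform_power_mult:
  assumes "a \<noteq> 0"
  shows "proj_zeros (linform a ^ n * H) =
           (if n = 0 then {} else {perp_class a}) \<union> proj_zeros H"
proof -
  have "eval2 (linform a ^ n) (c *s v) = 0" if "eval2 (linform a ^ n) v = 0" for c v
    using that
    by (auto simp: eval2_power eval2_linform scalar_product_def sum_2 mult.assoc
        simp flip: distrib_left)
  from proj_zeros_mult[of "linform a ^ n", OF this] show ?thesis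
    by (simp add: proj_zeros_power proj_zeros_linform[OF assms])
qed

theorem proposition3p12:
  fixes d j :: nat
    and a b :: "complex ^ 2"
    and F :: "complex poly poly"
    and Q1 Q2 :: "(complex ^ 2) set"
  assumes d: "3 \<le> d"
    and j: "1 \<le> j" "real j \<le> real d / 2"
    and indep: "a \<noteq> b" "vec.independent {a, b}"
    and F: "F = linform a ^ (d - j) * linform b ^ j"
    and Q: "proj_zeros (D_quadric d j a b) = {Q1, Q2}"
  shows "(j = 1 \<longrightarrow> Eig F = {perp_class a, Q1, Q2}) \<and>
         (j \<noteq> 1 \<longrightarrow> Eig F = {perp_class a, perp_class b, Q1, Q2})"
proof -
  have a: "a \<noteq> 0" and b: "b \<noteq> 0"
    using vec.dependent_zero indep(2) by blast+
  have m: "2 \<le> d - j" using d j by linarith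
  then have "Eig F = proj_zeros (linform a ^ (d - j - 1) *
      (linform b ^ (j - 1) * D_quadric d j a b))"
    unfolding Eig_def F using eig_poly_factor[of d j a b] j(1) by (simp add: mult.assoc)
  also have "\<dots> = {perp_class a} \<union> (if j = 1 then {} else {perp_class b}) \<union> {Q1, Q2}"
    using m j(1) by (auto simp: proj_zeros_linform_power_mult[OF a]
        proj_zeros_linform_power_mult[OF b] Q)
  finally show ?thesis by auto
qed

end
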